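(* Let $F=G-H$ on $\mathcal{X}=\{0,\dots,k-1\}^n$ with $G,H:\mathcal{X}\to\mathbb{R}$ normalized submodular functions, let $F^*=\min_{x\in\mathcal{X}}F(x)$, and let $\epsilon\ge0$, $\epsilon_x\ge0$. Let $\{x^t\}$ be generated by the algorithm DCA-LS (described in the context) with stopping tolerance $\epsilon$, where the subproblem at each iteration is solved up to accuracy $\epsilon_x$. Then for every performed iteration $t$: (a) $F(x^{t+1})\le F(x^t)+\epsilon_x$. (b) Let $(p,q)$ be the permutation chosen at iteration $t$ and let $y^0=\mathbf{0}$, $y^i=y^{i-1}+e_{p_i}$ for $i=1,\dots,(k-1)n$. If $(p,q)$ is row-stable and $F(x^t)-F(x^{t+1})\le\epsilon$, then $$F(x^t)\le F(y^i)+\epsilon+\epsilon_x\quad\text{for all } i\in\{0,1,\dots,(k-1)n\}.$$ (c) The algorithm converges to an $(\epsilon+\epsilon_x)$-local minimum of $F$ after at most $(F(x^0)-F^* )/\epsilon$ iterations; that is, if $\epsilon>0$ and the maximal number of iterations satisfies $T>(F(x^0)-F^* )/\epsilon$, then there is an iteration index $t\le (F(x^0)-F^* )/\epsilon$ at which the stopping criterion $F(x^t)-F(x^{t+1})\le\epsilon$ holds, and for this $t$ the point $x^t$ is an $(\epsilon+\epsilon_x)$-local minimum of $F$.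
   Context: Let $n\ge1$, $k\ge2$ be integers and $\mathcal{X}=\{0,\dots,k-1\}^n$. A function $F:\mathcal{X}\to\mathbb{R}$ is normalized if $F(\mathbf{0})=0$, and submodular if $F(x)+F(y)\ge F(\min\{x,y\})+F(\max\{x,y\})$ for all $x,y\in\mathcal{X}$ (componentwise min, max). $e_i$ are the standard basis vectors of $\mathbb{R}^n$. The neighbourhood of $x\in\mathcal{X}$ is $N_{\mathcal{X}}(x)=\{x'\in\mathcal{X}: \exists i,\ x'=x\pm e_i\}$. For $\delta\ge0$, $x\in\mathcal{X}$ is a $\delta$-local minimum of $F$ if $F(x)\le F(x')+\delta$ for all $x'\in N_{\mathcal{X}}(x)$. For $S\in\{\{0,1\},[0,1],\mathbb{R}\}$, $S_{\downarrow}^{n\times(k-1)}$ is the set of $X\in S^{n\times(k-1)}$ with non-increasing rows ($X_{i,j}\ge X_{i,j+1}$). A non-increasing permutation of a matrix $X\in\mathbb{R}^{n\times(k-1)}$ is an enumeration $(p,q)=((p_i,q_i))_{i=1}^{n(k-1)}$ of all index pairs with $X_{p_i,q_i}\ge X_{p_{i+1},q_{i+1}}$ for all $i$; it is row-stable if for all $i<j$ with $p_i=p_j$ one has $q_i<q_j$. Continuous extension of a normalized $F:\mathcal{X}\to\mathbb{R}$: for $X\in\mathbb{R}_{\downarrow}^{n\times(k-1)}$ with non-increasing permutation $(p,q)$, put $y^0=\mathbf{0}$, $y^i=y^{i-1}+e_{p_i}$, and $f_{\downarrow}(X)=\sum_{i=1}^{(k-1)n}X_{p_i,q_i}(F(y^i)-F(y^{i-1}))$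 (independent of the choice of $(p,q)$); $f_{\downarrow}(X)=+\infty$ for $X\notin\mathbb{R}_{\downarrow}^{n\times(k-1)}$. Let $g_{\downarrow},h_{\downarrow}$ be the continuous extensions of $G,H$. $\langle\cdot,\cdot\rangle_F$ is the Frobenius inner product, and $\partial h_\downarrow$ the convex subdifferential. $\Theta:\{0,1\}_{\downarrow}^{n\times(k-1)}\to\mathcal{X}$ is the bijection $\Theta(X)=X\mathbf{1}$, with $\Theta^{-1}(x)_{i,j}=1$ if $j\le x_i$ and $0$ if $j>x_i$. For $X\in[0,1]_{\downarrow}^{n\times(k-1)}$, $\mathrm{Round}_F(X)=y^{i^*}$ where, for a non-increasing permutation $(p,q)$ of $X$, $y^0=\mathbf{0}$ and $y^i=y^{i-1}+e_{p_i}$ for $i=1,\dots,(k-1)n$, and $i^*\in\arg\min_i F(y^i)$ (any choices). Algorithm DCA-LS. Input: $\epsilon\ge0$, $T\in\mathbb{N}$, $x^0\in\mathcal{X}$, $X^0=\Theta^{-1}(x^0)$. For $t=0,1,\dots,T-1$: 1. Choose $\bar x^t\in\arg\min_{x\in N_{\mathcal{X}}(x^t)}F(x)$. 2. Choose a common non-increasing permutation $(p,q)$ of $X^t$ and $\Theta^{-1}(\bar x^t)$ (preferably, but not necessarily, row-stable). 3. Choose the subgradient $Y^t\in\partial h_{\downarrow}(X^t)$ corresponding to $(p,q)$, i.e. $Y^t_{p_i,q_i}=H(y^i)-H(y^{i-1})$ for $i=1,\dots,(k-1)n$, with $y^0=\mathbf 0$, $y^i=y^{i-1}+e_{p_i}$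 (the choices are made such that this $Y^t$ belongs to $\partial h_{\downarrow}(X^t)$). 4. Compute $\tilde X^{t+1}$ minimizing $X\mapsto g_{\downarrow}(X)-\langle Y^t,X\rangle_F$ over $[0,1]_{\downarrow}^{n\times(k-1)}$. "Solved up to accuracy $\epsilon_x$" means that $\tilde X^{t+1}\in[0,1]_{\downarrow}^{n\times(k-1)}$ attains a value at most $\epsilon_x$ above the minimum. 5. If $\tilde X^{t+1}\in\{0,1\}_{\downarrow}^{n\times(k-1)}$, set $x^{t+1}=\Theta(\tilde X^{t+1})$ and $X^{t+1}=\tilde X^{t+1}$; otherwise set $x^{t+1}=\mathrm{Round}_F(\tilde X^{t+1})$ and $X^{t+1}=\Theta^{-1}(x^{t+1})$. 6. If $F(x^t)-F(x^{t+1})\le\epsilon$, stop. *)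

theory Defs
  imports Complex_Main "HOL-Library.Extended_Real"
begin

text \<open>
  Indices are 1-based. Integer vectors are functions on row indices and matrices are curried functions
  on index pairs, with value 0 outside \<open>{1..n}\<close> and \<open>{1..n} \<times> {1..k-1}\<close> respectively, so that
  equality of functions is equality of vectors and of matrices.
\<close>

definition cube :: "nat \<Rightarrow> nat \<Rightarrow> (nat \<Rightarrow> nat) set" where
  "cube n k = {x. (\<forall>i\<in>{1..n}. x i \<in> {0..k-1}) \<and> (\<forall>i. i \<notin> {1..n} \<longrightarrow> x i = 0)}"

definition add_unit :: "(nat \<Rightarrow> nat) \<Rightarrow> nat \<Rightarrow> nat \<Rightarrow> nat" where
  "add_unit x i = (\<lambda>j. x j + (if j = i then 1 else 0))"

definition normalized :: "((nat \<Rightarrow> nat) \<Rightarrow> real) \<Rightarrow> bool" where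
  "normalized F \<longleftrightarrow> F (\<lambda>_. 0) = 0"

definition submodular :: "nat \<Rightarrow> nat \<Rightarrow> ((nat \<Rightarrow> nat) \<Rightarrow> real) \<Rightarrow> bool" where
  "submodular n k F \<longleftrightarrow>
     (\<forall>x\<in>cube n k. \<forall>y\<in>cube n k.
        F x + F y \<ge> F (\<lambda>i. min (x i) (y i)) + F (\<lambda>i. max (x i) (y i)))"

text \<open>The relation \<open>x' = x - e\<^sub>i\<close> is written \<open>x = x' + e\<^sub>i\<close>, because subtraction on \<^typ>\<open>nat\<close> truncates.\<close>

definition nbhd :: "nat \<Rightarrow> nat \<Rightarrow> (nat \<Rightarrow> nat) \<Rightarrow> (nat \<Rightarrow> nat) set" where
  "nbhd n k x = {x' \<in> cube n k. \<exists>i\<in>{1..n}. x' = add_unit x i \<or> x = add_unit x' i}"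

definition local_minimum ::
  "nat \<Rightarrow> nat \<Rightarrow> ((nat \<Rightarrow> nat) \<Rightarrow> real) \<Rightarrow> real \<Rightarrow> (nat \<Rightarrow> nat) \<Rightarrow> bool" where
  "local_minimum n k F \<delta> x \<longleftrightarrow> x \<in> cube n k \<and> (\<forall>x'\<in>nbhd n k x. F x \<le> F x' + \<delta>)"

definition matrices :: "nat \<Rightarrow> nat \<Rightarrow> (nat \<Rightarrow> nat \<Rightarrow> real) set" where
  "matrices n k = {X. \<forall>i j. (i, j) \<notin> {1..n} \<times> {1..k-1} \<longrightarrow> X i j = 0}"

definition frobenius ::
  "nat \<Rightarrow> nat \<Rightarrow> (nat \<Rightarrow> nat \<Rightarrow> real) \<Rightarrow> (nat \<Rightarrow> nat \<Rightarrow> real) \<Rightarrow> real" where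
  "frobenius n k X Y = (\<Sum>i=1..n. \<Sum>j=1..k-1. X i j * Y i j)"

definition row_noninc :: "nat \<Rightarrow> nat \<Rightarrow> real set \<Rightarrow> (nat \<Rightarrow> nat \<Rightarrow> real) set" where
  "row_noninc n k S = {X \<in> matrices n k.
     (\<forall>i\<in>{1..n}. \<forall>j\<in>{1..k-1}. X i j \<in> S) \<and>
     (\<forall>i\<in>{1..n}. \<forall>j\<in>{1..<k-1}. X i j \<ge> X i (j + 1))}"

text \<open>
  An enumeration \<open>(p, q)\<close> of the index pairs is a single function \<open>pq\<close> on \<open>{1..n * (k-1)}\<close> with
  \<open>pq i = (p\<^sub>i, q\<^sub>i)\<close>.
\<close>

definition noninc_perm ::
  "nat \<Rightarrow> nat \<Rightarrow> (nat \<Rightarrow> nat \<Rightarrow> real) \<Rightarrow> (nat \<Rightarrow> nat \<times> nat) \<Rightarrow> bool" where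
  "noninc_perm n k X pq \<longleftrightarrow>
     bij_betw pq {1..n * (k-1)} ({1..n} \<times> {1..k-1}) \<and>
     (\<forall>i\<in>{1..<n * (k-1)}. X (fst (pq i)) (snd (pq i)) \<ge> X (fst (pq (i + 1))) (snd (pq (i + 1))))"

definition row_stable :: "nat \<Rightarrow> nat \<Rightarrow> (nat \<Rightarrow> nat \<times> nat) \<Rightarrow> bool" where
  "row_stable n k pq \<longleftrightarrow>
     (\<forall>i\<in>{1..n * (k-1)}. \<forall>j\<in>{1..n * (k-1)}.
        i < j \<and> fst (pq i) = fst (pq j) \<longrightarrow> snd (pq i) < snd (pq j))"

text \<open>\<open>chain pq i\<close> is the point \<open>y\<^sup>i\<close> determined by \<open>pq\<close>.\<close>

primrec chain :: "(nat \<Rightarrow> nat \<times> nat) \<Rightarrow> nat \<Rightarrow> nat \<Rightarrow> nat" where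
  "chain pq 0 = (\<lambda>_. 0)"
| "chain pq (Suc i) = add_unit (chain pq i) (fst (pq (Suc i)))"

text \<open>
  The value does not depend on the non-increasing permutation used, so an arbitrary one is selected.
\<close>

definition cont_ext ::
  "nat \<Rightarrow> nat \<Rightarrow> ((nat \<Rightarrow> nat) \<Rightarrow> real) \<Rightarrow> (nat \<Rightarrow> nat \<Rightarrow> real) \<Rightarrow> ereal" where
  "cont_ext n k F X =
     (if X \<in> row_noninc n k UNIV then
        let pq = (SOME pq. noninc_perm n k X pq) in
        ereal (\<Sum>i=1..(k-1) * n. X (fst (pq i)) (snd (pq i)) * (F (chain pq i) - F (chain pq (i - 1))))
      else \<infinity>)"

definition subdifferential ::
  "nat \<Rightarrow> nat \<Rightarrow> ((nat \<Rightarrow> nat \<Rightarrow> real) \<Rightarrow> ereal) \<Rightarrow> (nat \<Rightarrow> nat \<Rightarrow> real) \<Rightarrow> (nat \<Rightarrow> nat \<Rightarrow> real) set" where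
  "subdifferential n k h X = {Y \<in> matrices n k.
     \<forall>Z\<in>matrices n k. h Z \<ge> h X + ereal (frobenius n k Y (\<lambda>i j. Z i j - X i j))}"

text \<open>
  The row sums of the 0/1-matrices to which \<open>Theta\<close> is applied are natural numbers; the floor only
  converts them to type \<^typ>\<open>nat\<close>.
\<close>

definition Theta :: "nat \<Rightarrow> nat \<Rightarrow> (nat \<Rightarrow> nat \<Rightarrow> real) \<Rightarrow> nat \<Rightarrow> nat" where
  "Theta n k X = (\<lambda>i. if i \<in> {1..n} then nat \<lfloor>\<Sum>j=1..k-1. X i j\<rfloor> else 0)"

definition Theta_inv :: "nat \<Rightarrow> nat \<Rightarrow> (nat \<Rightarrow> nat) \<Rightarrow> nat \<Rightarrow> nat \<Rightarrow> real" where
  "Theta_inv n k x = (\<lambda>i j. if i \<in> {1..n} \<and> j \<in> {1..k-1} \<and> j \<le> x i then 1 else 0)"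

text \<open>The set of all possible outcomes of the rounding, over all choices of permutation and minimizer.\<close>

definition roundings ::
  "nat \<Rightarrow> nat \<Rightarrow> ((nat \<Rightarrow> nat) \<Rightarrow> real) \<Rightarrow> (nat \<Rightarrow> nat \<Rightarrow> real) \<Rightarrow> (nat \<Rightarrow> nat) set" where
  "roundings n k F X =
     {chain pq i | pq i. noninc_perm n k X pq \<and>
        is_arg_min (\<lambda>j. F (chain pq j)) (\<lambda>j. j \<in> {0..(k-1) * n}) i}"

definition solves_upto :: "('a \<Rightarrow> ereal) \<Rightarrow> 'a set \<Rightarrow> real \<Rightarrow> 'a \<Rightarrow> bool" where
  "solves_upto \<phi> D \<epsilon>\<^sub>x X \<longleftrightarrow> X \<in> D \<and> \<phi> X \<le> (INF Z\<in>D. \<phi> Z) + ereal \<epsilon>\<^sub>x"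

text \<open>
  One iteration takes \<open>(x, X)\<close> to \<open>(x', X')\<close>, with \<open>xbar\<close>, \<open>pq\<close>, \<open>Y\<close>, \<open>Xtilde\<close> the intermediate
  choices.
\<close>

definition dca_ls_step ::
  "nat \<Rightarrow> nat \<Rightarrow> ((nat \<Rightarrow> nat) \<Rightarrow> real) \<Rightarrow> ((nat \<Rightarrow> nat) \<Rightarrow> real) \<Rightarrow> ((nat \<Rightarrow> nat) \<Rightarrow> real) \<Rightarrow> real \<Rightarrow>
   (nat \<Rightarrow> nat) \<Rightarrow> (nat \<Rightarrow> nat \<Rightarrow> real) \<Rightarrow>
   (nat \<Rightarrow> nat) \<Rightarrow> (nat \<Rightarrow> nat \<times> nat) \<Rightarrow> (nat \<Rightarrow> nat \<Rightarrow> real) \<Rightarrow> (nat \<Rightarrow> nat \<Rightarrow> real) \<Rightarrow>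
   (nat \<Rightarrow> nat) \<Rightarrow> (nat \<Rightarrow> nat \<Rightarrow> real) \<Rightarrow> bool" where
  "dca_ls_step n k F G H \<epsilon>\<^sub>x x X xbar pq Y Xtilde x' X' \<longleftrightarrow>
     is_arg_min F (\<lambda>z. z \<in> nbhd n k x) xbar \<and>
     noninc_perm n k X pq \<and> noninc_perm n k (Theta_inv n k xbar) pq \<and>
     Y \<in> subdifferential n k (cont_ext n k H) X \<and>
     (\<forall>i\<in>{1..(k-1) * n}. Y (fst (pq i)) (snd (pq i)) = H (chain pq i) - H (chain pq (i - 1))) \<and>
     solves_upto (\<lambda>Z. cont_ext n k G Z - ereal (frobenius n k Y Z)) (row_noninc n k {0..1}) \<epsilon>\<^sub>x Xtilde \<and>
     (if Xtilde \<in> row_noninc n k {0, 1} then x' = Theta n k Xtilde \<and> X' = Xtilde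
      else x' \<in> roundings n k F Xtilde \<and> X' = Theta_inv n k x')"

text \<open>
  A complete execution in which exactly the iterations \<open>t < M\<close> are performed: an iteration follows
  iteration \<open>t\<close> only if the stopping criterion failed at \<open>t\<close>, and the execution ends because either
  \<open>T\<close> iterations have been performed or the stopping criterion held at the last one. Values of the
  sequences at indices that are never reached are unconstrained.
\<close>

definition dca_ls_run ::
  "nat \<Rightarrow> nat \<Rightarrow> ((nat \<Rightarrow> nat) \<Rightarrow> real) \<Rightarrow> ((nat \<Rightarrow> nat) \<Rightarrow> real) \<Rightarrow> ((nat \<Rightarrow> nat) \<Rightarrow> real) \<Rightarrow>
   real \<Rightarrow> real \<Rightarrow> nat \<Rightarrow> nat \<Rightarrow>
   (nat \<Rightarrow> nat \<Rightarrow> nat) \<Rightarrow> (nat \<Rightarrow> nat \<Rightarrow> nat \<Rightarrow> real) \<Rightarrow>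
   (nat \<Rightarrow> nat \<Rightarrow> nat) \<Rightarrow> (nat \<Rightarrow> nat \<Rightarrow> nat \<times> nat) \<Rightarrow>
   (nat \<Rightarrow> nat \<Rightarrow> nat \<Rightarrow> real) \<Rightarrow> (nat \<Rightarrow> nat \<Rightarrow> nat \<Rightarrow> real) \<Rightarrow> bool" where
  "dca_ls_run n k F G H \<epsilon> \<epsilon>\<^sub>x T M x X xbar pq Y Xtilde \<longleftrightarrow>
     x 0 \<in> cube n k \<and> X 0 = Theta_inv n k (x 0) \<and>
     (\<forall>t<M. dca_ls_step n k F G H \<epsilon>\<^sub>x
        (x t) (X t) (xbar t) (pq t) (Y t) (Xtilde (t + 1)) (x (t + 1)) (X (t + 1))) \<and>
     (\<forall>t. t + 1 < M \<longrightarrow> \<not> F (x t) - F (x (t + 1)) \<le> \<epsilon>) \<and>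
     M \<le> T \<and> (M = T \<or> (\<exists>t. M = t + 1 \<and> F (x t) - F (x (t + 1)) \<le> \<epsilon>))"

end

theory Submission
  imports Defs
begin

text \<open>
  The theorem rests on one inequality about a single iteration (\<open>dca_ls_step_bound\<close>): if \<open>pq\<close> is the
  enumeration chosen in the iteration, \<open>x'\<close> the next iterate, and \<open>z\<close> any lattice point whose matrix
  \<open>\<Theta>\<^sup>-\<^sup>1(z)\<close> is also sorted by \<open>pq\<close>, then \<open>F x' \<le> F z + \<epsilon>\<^sub>x\<close>. Write \<open>g\<close>, \<open>h\<close>, \<open>f\<close> for the continuous
  extensions of \<open>G\<close>, \<open>H\<close>, \<open>F\<close>, so that \<open>f = g - h\<close>, and \<open>X\<close>, \<open>Xt\<close> for the current matrix and the
  approximate solution of the subproblem. Since the entries of \<open>Y\<close> are the increments of \<open>H\<close> along the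
  chain of \<open>pq\<close>, the linear function \<open>\<langle>Y, _\<rangle>\<close> agrees with \<open>h\<close> at every matrix sorted by \<open>pq\<close>, in
  particular at \<open>X\<close> and at \<open>\<Theta>\<^sup>-\<^sup>1(z)\<close>. Together with the subgradient inequality this gives

    \<open>F x' \<le> f(Xt) = g(Xt) - h(Xt) \<le> g(Xt) - \<langle>Y, Xt\<rangle> \<le> g(\<Theta>\<^sup>-\<^sup>1(z)) - \<langle>Y, \<Theta>\<^sup>-\<^sup>1(z)\<rangle> + \<epsilon>\<^sub>x = F z + \<epsilon>\<^sub>x\<close>.

  The first inequality is the rounding guarantee: for entries in \<open>[0, 1]\<close>, summation by parts exhibits
  \<open>f(Xt)\<close> as a convex combination of the values of \<open>F\<close> along the chain of \<open>Xt\<close>, and rounding picks the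
  smallest of these values; a \<open>0/1\<close> solution is kept as it is and gives equality. The chain that defines \<open>f(Xt)\<close> and the one used by the rounding may come from
  different enumerations, so the value of the extension must not depend on the enumeration; this is
  proved by expressing it through the superlevel sets of the matrix (\<open>sorted_sum_by_levels\<close>).

  The three claims are three choices of \<open>z\<close>. The current point \<open>z = x\<close> gives the bounded increase. If
  \<open>pq\<close> is row-stable, the first \<open>i\<close> positions of the enumeration fill each row from the left, so every
  point of its chain is an admissible \<open>z\<close>; combined with the stopping criterion this gives the bound along
  the chain. The best neighbour \<open>z = xbar\<close>, admissible because \<open>pq\<close> sorts both matrices, gives local
  minimality once the stopping criterion holds. That it must hold early is a budget argument: each
  iteration that fails the criterion lowers \<open>F\<close> by more than \<open>\<epsilon>\<close>, and \<open>F\<close> cannot fall below its minimum.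
\<close>

section \<open>Enumerations of index pairs and their chains\<close>

lemma downset_eq_card_interval:
  fixes A :: "nat set"
  assumes sub: "A \<subseteq> {1..N}"
    and down: "\<And>i j. i \<in> A \<Longrightarrow> 1 \<le> j \<Longrightarrow> j \<le> i \<Longrightarrow> j \<in> A"
  shows "A = {1..card A}"
proof (cases "A = {}")
  case False
  have fin: "finite A"
    using sub finite_subset by blast
  have "A = {1..Max A}"
  proof
    show "A \<subseteq> {1..Max A}"
      using sub fin by auto
    show "{1..Max A} \<subseteq> A"
      using down[OF Max_in[OF fin False]] by auto
  qed
  then show ?thesis
    by (metis card_atLeastAtMost diff_Suc_1)
qed simp

lemma sum_increments:
  fixes D :: "nat \<Rightarrow> real"
  assumes "m \<le> m'"
  shows "(\<Sum>i\<in>{1..m'} - {1..m}. D i - D (i - 1)) = D m' - D m"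
  using assms
proof (induction m' rule: dec_induct)
  case (step j)
  have "{1..Suc j} - {1..m} = insert (Suc j) ({1..j} - {1..m})"
    using step.hyps by auto
  then show ?case
    using step by simp
qed simp

lemma chain_eq_card: "chain pq m r = card {i \<in> {1..m}. fst (pq i) = r}"
proof (induction m)
  case (Suc m)
  have "{i \<in> {1..Suc m}. fst (pq i) = r} =
    (if fst (pq (Suc m)) = r then insert (Suc m) {i \<in> {1..m}. fst (pq i) = r}
     else {i \<in> {1..m}. fst (pq i) = r})"
    by (auto simp: le_Suc_eq)
  then show ?case
    using Suc by (auto simp: add_unit_def)
qed simp

text \<open>
  The point \<open>y\<^sup>m\<close> counts, row by row, the positions enumerated so far; it therefore depends only on the
  set of the first \<open>m\<close> positions and not on their order.
\<close>

lemma chain_eq_card_row: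
  assumes "inj_on pq {1..m}"
  shows "chain pq m r = card {j. (r, j) \<in> pq ` {1..m}}"
proof -
  have "bij_betw (snd \<circ> pq) {i \<in> {1..m}. fst (pq i) = r} {j. (r, j) \<in> pq ` {1..m}}"
    unfolding bij_betw_def
  proof
    show "inj_on (snd \<circ> pq) {i \<in> {1..m}. fst (pq i) = r}"
    proof (rule inj_onI)
      fix a b
      assume a: "a \<in> {i \<in> {1..m}. fst (pq i) = r}" and b: "b \<in> {i \<in> {1..m}. fst (pq i) = r}"
        and "(snd \<circ> pq) a = (snd \<circ> pq) b"
      then have "pq a = pq b"
        by (auto intro: prod_eqI)
      then show "a = b"
        using a b inj_onD[OF assms] by blast
    qed
    show "(snd \<circ> pq) ` {i \<in> {1..m}. fst (pq i) = r} = {j. (r, j) \<in> pq ` {1..m}}"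
      unfolding set_eq_iff image_iff by (force simp: prod_eq_iff)
  qed
  then show ?thesis
    by (simp add: chain_eq_card bij_betw_same_card)
qed

lemma noninc_perm_bij:
  "noninc_perm n k X pq \<Longrightarrow> bij_betw pq {1..(k-1) * n} ({1..n} \<times> {1..k-1})"
  by (simp add: noninc_perm_def mult.commute)

lemma noninc_perm_antimono:
  assumes pq: "noninc_perm n k X pq" and "1 \<le> i" "i \<le> j" "j \<le> (k-1) * n"
  shows "X (fst (pq j)) (snd (pq j)) \<le> X (fst (pq i)) (snd (pq i))"
  using assms(3,4)
proof (induction j rule: dec_induct)
  case (step l)
  have "X (fst (pq (l + 1))) (snd (pq (l + 1))) \<le> X (fst (pq l)) (snd (pq l))"
    using pq step assms(2) unfolding noninc_perm_def by (auto simp: mult.commute)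
  then show ?case
    using step by simp
qed simp

lemma chain_in_cube:
  assumes bij: "bij_betw pq {1..(k-1) * n} ({1..n} \<times> {1..k-1})" and "m \<le> (k-1) * n"
  shows "chain pq m \<in> cube n k"
proof -
  have sub: "{1..m} \<subseteq> {1..(k-1) * n}"
    using assms(2) by auto
  have im: "pq ` {1..m} \<subseteq> {1..n} \<times> {1..k-1}"
    using bij_betw_imp_surj_on[OF bij] sub by blast
  have chain: "chain pq m r = card {j. (r, j) \<in> pq ` {1..m}}" for r
    by (rule chain_eq_card_row) (use bij sub in \<open>auto simp: bij_betw_def intro: inj_on_subset\<close>)
  have "card {j. (r, j) \<in> pq ` {1..m}} \<le> card {1..k-1}" for r
    by (rule card_mono) (use im in auto)
  moreover have "{j. (r, j) \<in> pq ` {1..m}} = {}" if "r \<notin> {1..n}" for r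
    using im that by auto
  ultimately show ?thesis
    by (auto simp: cube_def chain)
qed

text \<open>
  Sorting the list of all positions by decreasing entry. An enumeration is already at hand for every
  matrix of the algorithm except a \<open>0/1\<close> solution of the subproblem, which is not rounded.
\<close>

lemma noninc_perm_exists: "\<exists>pq. noninc_perm n k X pq"
proof -
  let ?f = "\<lambda>p::nat \<times> nat. - X (fst p) (snd p)"
  obtain ps0 where ps0: "set ps0 = {1..n} \<times> {1..k-1}" "distinct ps0"
    using finite_distinct_list[of "{1..n} \<times> {1..k-1}"] by auto
  define ps where "ps = sort_key ?f ps0"
  have set: "set ps = {1..n} \<times> {1..k-1}" and dist: "distinct ps"
    using ps0 by (auto simp: ps_def)
  have len: "length ps = n * (k-1)"
    using distinct_card[OF dist] set by simp
  have sorted: "sorted (map ?f ps)"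
    by (simp add: ps_def)
  have "bij_betw (\<lambda>i. ps ! (i - 1)) {1..n * (k-1)} ({1..n} \<times> {1..k-1})"
  proof -
    have "bij_betw (\<lambda>i. i - 1) {1..n * (k-1)} {..<n * (k-1)}"
      by (rule bij_betw_byWitness[where f' = Suc]) auto
    moreover have "bij_betw ((!) ps) {..<n * (k-1)} ({1..n} \<times> {1..k-1})"
      by (rule bij_betw_nth[OF dist]) (simp_all add: len set)
    ultimately show ?thesis
      using bij_betw_trans by (fastforce simp: comp_def)
  qed
  moreover have "?f (ps ! (i - 1)) \<le> ?f (ps ! (i + 1 - 1))" if "i \<in> {1..<n * (k-1)}" for i
    using sorted_nth_mono[OF sorted, of "i - 1" i] that len by simp
  ultimately have "noninc_perm n k X (\<lambda>i. ps ! (i - 1))"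
    unfolding noninc_perm_def by auto
  then show ?thesis
    by blast
qed

section \<open>The continuous extension does not depend on the enumeration\<close>

definition level_counts :: "nat \<Rightarrow> nat \<Rightarrow> (real \<Rightarrow> bool) \<Rightarrow> (nat \<Rightarrow> nat \<Rightarrow> real) \<Rightarrow> nat \<Rightarrow> nat" where
  "level_counts n k P X = (\<lambda>r. card {j \<in> {1..k-1}. r \<in> {1..n} \<and> P (X r j)})"

text \<open>
  A superlevel set of the entries, strict or not, is exhausted by an initial segment of any enumeration
  in non-increasing order, so the corresponding point of the chain is the same for all of them. The
  monotone predicate \<open>P\<close> covers both kinds of superlevel set.
\<close>

lemma noninc_perm_level:
  assumes pq: "noninc_perm n k X pq" and P: "\<And>u v. u \<le> v \<Longrightarrow> P u \<Longrightarrow> P v"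
  obtains m where "m \<le> (k-1) * n"
    and "{i \<in> {1..(k-1) * n}. P (X (fst (pq i)) (snd (pq i)))} = {1..m}"
    and "chain pq m = level_counts n k P X"
proof -
  let ?N = "(k-1) * n"
  let ?A = "{i \<in> {1..?N}. P (X (fst (pq i)) (snd (pq i)))}"
  have bij: "bij_betw pq {1..?N} ({1..n} \<times> {1..k-1})"
    by (rule noninc_perm_bij[OF pq])
  have A: "?A = {1..card ?A}"
  proof (rule downset_eq_card_interval[where N = ?N])
    fix i j assume "i \<in> ?A" "1 \<le> j" "j \<le> i"
    then show "j \<in> ?A"
      using P noninc_perm_antimono[OF pq, of j i] by auto
  qed auto
  have "card ?A \<le> card {1..?N}"
    by (rule card_mono) auto
  then have le: "card ?A \<le> ?N"
    by simp
  have "chain pq (card ?A) r = level_counts n k P X r" for r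
  proof -
    have inj: "inj_on pq {1..card ?A}"
      using bij le by (auto simp: bij_betw_def intro: inj_on_subset)
    have "pq ` ?A = {p \<in> {1..n} \<times> {1..k-1}. P (X (fst p) (snd p))}"
      unfolding bij_betw_imp_surj_on[OF bij, symmetric] by blast
    then have "pq ` {1..card ?A} = {p \<in> {1..n} \<times> {1..k-1}. P (X (fst p) (snd p))}"
      using A by simp
    then show ?thesis
      unfolding chain_eq_card_row[OF inj] level_counts_def
      by (intro arg_cong[where f = card]) auto
  qed
  then show ?thesis
    using that[OF le A] by blast
qed

definition sorted_sum ::
  "nat \<Rightarrow> nat \<Rightarrow> ((nat \<Rightarrow> nat) \<Rightarrow> real) \<Rightarrow> (nat \<Rightarrow> nat \<times> nat) \<Rightarrow> (nat \<Rightarrow> nat \<Rightarrow> real) \<Rightarrow> real" where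
  "sorted_sum n k F pq X =
     (\<Sum>i=1..(k-1) * n. X (fst (pq i)) (snd (pq i)) * (F (chain pq i) - F (chain pq (i - 1))))"

text \<open>
  The positions carrying one value \<open>v\<close> form a block of consecutive indices, on which the increments of
  \<open>F\<close> telescope. Only the two ends of the block matter, and these are superlevel sets. The right-hand
  side does not mention the enumeration, which proves independence.
\<close>

lemma sorted_sum_by_levels:
  assumes pq: "noninc_perm n k X pq"
  shows "sorted_sum n k F pq X =
    (\<Sum>v\<in>(\<lambda>(i, j). X i j) ` ({1..n} \<times> {1..k-1}).
       v * (F (level_counts n k (\<lambda>u. v \<le> u) X) - F (level_counts n k (\<lambda>u. v < u) X)))"
proof -
  let ?N = "(k-1) * n"
  let ?a = "\<lambda>i. X (fst (pq i)) (snd (pq i))"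
  let ?d = "\<lambda>i. F (chain pq i) - F (chain pq (i - 1))"
  have image: "?a ` {1..?N} = (\<lambda>(i, j). X i j) ` ({1..n} \<times> {1..k-1})"
  proof -
    have "?a ` {1..?N} = (\<lambda>(i, j). X i j) ` pq ` {1..?N}"
      by (simp add: image_image case_prod_beta)
    then show ?thesis
      using bij_betw_imp_surj_on[OF noninc_perm_bij[OF pq]] by simp
  qed
  have "sorted_sum n k F pq X = (\<Sum>v\<in>?a ` {1..?N}. \<Sum>i | i \<in> {1..?N} \<and> ?a i = v. ?a i * ?d i)"
    unfolding sorted_sum_def by (rule sum.image_gen) simp
  also have "\<dots> = (\<Sum>v\<in>?a ` {1..?N}.
      v * (F (level_counts n k (\<lambda>u. v \<le> u) X) - F (level_counts n k (\<lambda>u. v < u) X)))"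
  proof (rule sum.cong[OF refl])
    fix v
    obtain m where m: "{i \<in> {1..?N}. v < ?a i} = {1..m}"
        "chain pq m = level_counts n k (\<lambda>u. v < u) X"
      by (rule noninc_perm_level[OF pq, where P = "\<lambda>u. v < u"]) auto
    obtain m' where m': "{i \<in> {1..?N}. v \<le> ?a i} = {1..m'}"
        "chain pq m' = level_counts n k (\<lambda>u. v \<le> u) X"
      by (rule noninc_perm_level[OF pq, where P = "\<lambda>u. v \<le> u"]) auto
    have "{1..m} \<subseteq> {1..m'}"
      unfolding m(1)[symmetric] m'(1)[symmetric] by auto
    then have "m \<le> m'"
      by (cases "m = 0") auto
    have level: "{i. i \<in> {1..?N} \<and> ?a i = v} = {1..m'} - {1..m}"
      unfolding m(1)[symmetric] m'(1)[symmetric] by auto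
    have "(\<Sum>i | i \<in> {1..?N} \<and> ?a i = v. ?a i * ?d i) = (\<Sum>i | i \<in> {1..?N} \<and> ?a i = v. v * ?d i)"
      by (rule sum.cong) simp_all
    also have "\<dots> = v * (\<Sum>i\<in>{1..m'} - {1..m}. ?d i)"
      unfolding level by (rule sum_distrib_left[symmetric])
    also have "\<dots> = v * (F (chain pq m') - F (chain pq m))"
      by (simp only: sum_increments[OF \<open>m \<le> m'\<close>, where D = "\<lambda>i. F (chain pq i)"])
    finally show "(\<Sum>i | i \<in> {1..?N} \<and> ?a i = v. ?a i * ?d i) =
        v * (F (level_counts n k (\<lambda>u. v \<le> u) X) - F (level_counts n k (\<lambda>u. v < u) X))"
      by (simp add: m m')
  qed
  finally show ?thesis
    by (simp only: image)
qed

lemma cont_ext_eq_sorted_sum: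
  assumes X: "X \<in> row_noninc n k S" and pq: "noninc_perm n k X pq"
  shows "cont_ext n k F X = ereal (sorted_sum n k F pq X)"
proof -
  let ?pq = "SOME pq. noninc_perm n k X pq"
  have "noninc_perm n k X ?pq"
    by (rule someI[of "noninc_perm n k X", OF pq])
  then have "sorted_sum n k F ?pq X = sorted_sum n k F pq X"
    using pq by (simp add: sorted_sum_by_levels)
  moreover have "X \<in> row_noninc n k UNIV"
    using X by (auto simp: row_noninc_def)
  ultimately show ?thesis
    by (simp add: cont_ext_def Let_def sorted_sum_def)
qed

section \<open>Lattice points as binary matrices\<close>

lemma frobenius_eq_perm_sum:
  assumes "bij_betw pq {1..(k-1) * n} ({1..n} \<times> {1..k-1})"
  shows "frobenius n k Y X =
    (\<Sum>i=1..(k-1) * n. X (fst (pq i)) (snd (pq i)) * Y (fst (pq i)) (snd (pq i)))"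
proof -
  have "frobenius n k Y X = (\<Sum>p\<in>{1..n} \<times> {1..k-1}. X (fst p) (snd p) * Y (fst p) (snd p))"
    by (simp add: frobenius_def sum.cartesian_product case_prod_beta mult.commute)
  also have "\<dots> = (\<Sum>i=1..(k-1) * n. X (fst (pq i)) (snd (pq i)) * Y (fst (pq i)) (snd (pq i)))"
    by (rule sum.reindex_bij_betw[OF assms, symmetric])
  finally show ?thesis .
qed

lemma frobenius_diff: "frobenius n k Y (\<lambda>i j. Z i j - X i j) = frobenius n k Y Z - frobenius n k Y X"
  by (simp add: frobenius_def algebra_simps sum_subtractf)

lemma Theta_inv_row_noninc: "{0, 1} \<subseteq> S \<Longrightarrow> Theta_inv n k z \<in> row_noninc n k S"
  by (auto simp: row_noninc_def matrices_def Theta_inv_def)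

text \<open>
  The extension interpolates \<open>F\<close>: the entries equal to \<open>1\<close> come first, and the chain reaches \<open>z\<close>
  exactly when they are used up, so the sum telescopes to \<open>F z - F 0\<close>.
\<close>

lemma sorted_sum_Theta_inv:
  assumes z: "z \<in> cube n k" and pq: "noninc_perm n k (Theta_inv n k z) pq"
    and F0: "F (\<lambda>_. 0) = 0"
  shows "sorted_sum n k F pq (Theta_inv n k z) = F z"
proof -
  let ?N = "(k-1) * n"
  let ?a = "\<lambda>i. Theta_inv n k z (fst (pq i)) (snd (pq i))"
  obtain m where m: "m \<le> ?N" "{i \<in> {1..?N}. 1 \<le> ?a i} = {1..m}"
      "chain pq m = level_counts n k (\<lambda>u. 1 \<le> u) (Theta_inv n k z)"
    by (rule noninc_perm_level[OF pq, where P = "\<lambda>u. 1 \<le> u"]) auto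
  have "level_counts n k (\<lambda>u. 1 \<le> u) (Theta_inv n k z) r = z r" for r
  proof (cases "r \<in> {1..n}")
    case True
    then have "z r \<le> k - 1"
      using z by (auto simp: cube_def)
    then have "{j \<in> {1..k-1}. r \<in> {1..n} \<and> 1 \<le> Theta_inv n k z r j} = {1..z r}"
      using True by (auto simp: Theta_inv_def split: if_splits)
    then show ?thesis
      by (simp add: level_counts_def)
  next
    case False
    then show ?thesis
      using z by (auto simp: level_counts_def cube_def)
  qed
  then have chain: "chain pq m = z"
    using m(3) by auto
  have a: "?a i = (if i \<in> {1..m} then 1 else 0)" if "i \<in> {1..?N}" for i
  proof -
    have "i \<in> {1..m} \<longleftrightarrow> 1 \<le> ?a i"
      using that unfolding m(2)[symmetric] by simp
    then show ?thesis
      by (simp add: Theta_inv_def split: if_splits)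
  qed
  have "sorted_sum n k F pq (Theta_inv n k z) =
      (\<Sum>i\<in>{1..m}. F (chain pq i) - F (chain pq (i - 1)))"
    unfolding sorted_sum_def
    by (rule sum.mono_neutral_cong_right) (use m(1) a in auto)
  also have "\<dots> = F (chain pq m) - F (chain pq 0)"
    using sum_increments[of 0 m "\<lambda>i. F (chain pq i)"] by simp
  finally show ?thesis
    by (simp add: chain F0)
qed

lemma binary_row_noninc_eq_Theta_inv:
  assumes X: "X \<in> row_noninc n k {0, 1}"
  shows "Theta n k X \<in> cube n k" and "Theta_inv n k (Theta n k X) = X"
proof -
  let ?A = "\<lambda>i. {j \<in> {1..k-1}. X i j = 1}"
  have val: "X i j = 0 \<or> X i j = 1" if "i \<in> {1..n}" "j \<in> {1..k-1}" for i j
    using X that by (auto simp: row_noninc_def)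
  have dec: "X i (Suc j) \<le> X i j" if "i \<in> {1..n}" "j \<in> {1..<k-1}" for i j
    using X that by (auto simp: row_noninc_def)
  have Theta: "Theta n k X i = card (?A i)" if i: "i \<in> {1..n}" for i
  proof -
    have "(\<Sum>j=1..k-1. X i j) = (\<Sum>j\<in>?A i. 1)"
    proof (rule sum.mono_neutral_cong_right)
      show "\<forall>j\<in>{1..k-1} - ?A i. X i j = 0"
        using val[OF i] by blast
    qed auto
    then show ?thesis
      using i by (simp add: Theta_def)
  qed
  have "card (?A i) \<le> card {1..k-1}" for i
    by (rule card_mono) auto
  then show "Theta n k X \<in> cube n k"
    using Theta by (auto simp: cube_def Theta_def[of n k X, THEN fun_cong])
  have A: "?A i = {1..card (?A i)}" if i: "i \<in> {1..n}" for i
  proof (rule downset_eq_card_interval[where N = "k - 1"])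
    fix l j assume l: "l \<in> ?A i" and j: "1 \<le> j" "j \<le> l"
    have "X i l \<le> X i j"
      using j(2)
    proof (induction rule: inc_induct)
      case (step r)
      then show ?case
        using dec[OF i, of r] l j by auto
    qed simp
    then show "j \<in> ?A i"
      using l j val[OF i, of j] by auto
  qed auto
  show "Theta_inv n k (Theta n k X) = X"
  proof (intro ext)
    fix i j
    show "Theta_inv n k (Theta n k X) i j = X i j"
    proof (cases "i \<in> {1..n} \<and> j \<in> {1..k-1}")
      case True
      then have "j \<in> ?A i \<longleftrightarrow> j \<in> {1..card (?A i)}"
        using A[of i] by blast
      then have "j \<le> card (?A i) \<longleftrightarrow> X i j = 1"
        using True by simp
      then show ?thesis
        using True Theta[of i] val[of i j] by (auto simp: Theta_inv_def)
    next
      case False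
      then show ?thesis
        using X by (auto simp: Theta_inv_def row_noninc_def matrices_def)
    qed
  qed
qed

text \<open>
  Row-stability enumerates each row from left to right. Hence the first \<open>m\<close> positions occupy a left
  segment of every row, which makes their indicator matrix equal to \<open>\<Theta>\<^sup>-\<^sup>1(y\<^sup>m)\<close>. In the order given by
  \<open>pq\<close> this matrix reads \<open>1, \<dots>, 1, 0, \<dots>, 0\<close>.
\<close>

lemma noninc_perm_Theta_inv_chain:
  assumes bij: "bij_betw pq {1..(k-1) * n} ({1..n} \<times> {1..k-1})"
    and stable: "row_stable n k pq" and m: "m \<le> (k-1) * n"
  shows "noninc_perm n k (Theta_inv n k (chain pq m)) pq"
proof -
  let ?N = "(k-1) * n"
  have inj: "inj_on pq {1..?N}" and im: "pq ` {1..?N} = {1..n} \<times> {1..k-1}"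
    using bij by (auto simp: bij_betw_def)
  have sub: "{1..m} \<subseteq> {1..?N}"
    using m by auto
  have row: "{j. (r, j) \<in> pq ` {1..m}} = {1..chain pq m r}" for r
    unfolding chain_eq_card_row[OF inj_on_subset[OF inj sub]]
  proof (rule downset_eq_card_interval[where N = "k - 1"])
    have "pq ` {1..m} \<subseteq> {1..n} \<times> {1..k-1}"
      using im sub by blast
    then show "{j. (r, j) \<in> pq ` {1..m}} \<subseteq> {1..k-1}"
      by auto
    fix j j' assume "j \<in> {j. (r, j) \<in> pq ` {1..m}}" and j': "1 \<le> j'" "j' \<le> j"
    then obtain a where a: "a \<in> {1..m}" "pq a = (r, j)"
      by auto
    then have "(r, j) \<in> {1..n} \<times> {1..k-1}"
      using im sub by (metis imageI subsetD)
    then have "(r, j') \<in> pq ` {1..?N}"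
      using im j' by auto
    then obtain b where b: "b \<in> {1..?N}" "pq b = (r, j')"
      by auto
    have "b \<le> a"
    proof (rule ccontr)
      assume "\<not> b \<le> a"
      then have "a < b \<and> fst (pq a) = fst (pq b)"
        using a b by simp
      then have "snd (pq a) < snd (pq b)"
        using stable a(1) b(1) sub
        unfolding row_stable_def mult.commute[of n "k - 1"] by blast
      then show False
        using a b j' by simp
    qed
    then show "j' \<in> {j. (r, j) \<in> pq ` {1..m}}"
      using a b by (auto simp: image_iff intro!: bexI[of _ b])
  qed
  have val: "Theta_inv n k (chain pq m) (fst (pq i)) (snd (pq i)) = (if i \<le> m then 1 else 0)"
    if i: "i \<in> {1..?N}" for i
  proof -
    have mem: "pq i \<in> {1..n} \<times> {1..k-1}"
      using im i by blast
    have "snd (pq i) \<le> chain pq m (fst (pq i)) \<longleftrightarrow> snd (pq i) \<in> {1..chain pq m (fst (pq i))}"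
      using mem by (auto simp: mem_Times_iff)
    also have "\<dots> \<longleftrightarrow> pq i \<in> pq ` {1..m}"
      unfolding row[symmetric] by simp
    also have "\<dots> \<longleftrightarrow> i \<le> m"
      using inj_on_image_mem_iff[OF inj i sub] i by auto
    finally show ?thesis
      using mem by (auto simp: Theta_inv_def mem_Times_iff)
  qed
  show ?thesis
    unfolding noninc_perm_def using bij by (auto simp: mult.commute val)
qed

section \<open>The rounding guarantee\<close>

text \<open>
  With \<open>a 0 = 1\<close> and \<open>a (N + 1) = 0\<close>, summation by parts turns \<open>D 0\<close> plus the sum into
  \<open>\<Sum>i\<le>N. (a i - a (i + 1)) * D i\<close>, a convex combination of values that are at least \<open>c\<close>.
\<close>

lemma abel_lower_bound:
  fixes a D :: "nat \<Rightarrow> real"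
  assumes a: "\<And>i. 1 \<le> i \<Longrightarrow> i \<le> N \<Longrightarrow> a i \<in> {0..1}"
    and dec: "\<And>i. 1 \<le> i \<Longrightarrow> i < N \<Longrightarrow> a (Suc i) \<le> a i"
    and D: "\<And>i. i \<le> N \<Longrightarrow> c \<le> D i"
  shows "c - D 0 \<le> (\<Sum>i=1..N. a i * (D i - D (i - 1)))"
proof (cases "N = 0")
  case True
  then show ?thesis
    using D[of 0] by simp
next
  case False
  \<comment> \<open>The partial sums keep the boundary term at \<open>m\<close>, which the next step of the summation by parts needs.\<close>
  have "a m * (D m - c) - (D 0 - c) \<le> (\<Sum>i=1..m. a i * (D i - D (i - 1)))"
    if "1 \<le> m" "m \<le> N" for m
    using that
  proof (induction m rule: dec_induct)
    case base
    have "0 \<le> (1 - a 1) * (D 0 - c)"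
      using a[of 1] D[of 0] base by simp
    then show ?case
      by (simp add: algebra_simps)
  next
    case (step m)
    have "0 \<le> (a m - a (Suc m)) * (D m - c)"
      using dec[of m] D[of m] step by simp
    then show ?case
      using step by (simp add: algebra_simps)
  qed
  from this[of N] have "a N * (D N - c) - (D 0 - c) \<le> (\<Sum>i=1..N. a i * (D i - D (i - 1)))"
    using False by simp
  moreover have "0 \<le> a N * (D N - c)"
    using a[of N] D[of N] False by simp
  ultimately show ?thesis
    by simp
qed

lemma rounding_le_sorted_sum:
  assumes X: "X \<in> row_noninc n k {0..1}" and z: "z \<in> roundings n k F X"
    and F0: "F (\<lambda>_. 0) = 0"
  obtains pq where "noninc_perm n k X pq" and "z \<in> cube n k" and "F z \<le> sorted_sum n k F pq X"
proof -
  let ?N = "(k-1) * n"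
  obtain pq i where z_def: "z = chain pq i" and pq: "noninc_perm n k X pq"
    and min: "is_arg_min (\<lambda>j. F (chain pq j)) (\<lambda>j. j \<in> {0..?N}) i"
    using z unfolding roundings_def by auto
  have i: "i \<le> ?N" and le: "\<And>j. j \<le> ?N \<Longrightarrow> F z \<le> F (chain pq j)"
    using min unfolding is_arg_min_linorder z_def by auto
  have "F z - F (chain pq 0) \<le> sorted_sum n k F pq X"
    unfolding sorted_sum_def
  proof (rule abel_lower_bound)
    fix l assume l: "1 \<le> l" "l \<le> ?N"
    then have "pq l \<in> {1..n} \<times> {1..k-1}"
      by (intro bij_betw_apply[OF noninc_perm_bij[OF pq]]) simp
    then show "X (fst (pq l)) (snd (pq l)) \<in> {0..1}"
      using X unfolding row_noninc_def by (auto simp: mem_Times_iff)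
  next
    fix l assume "1 \<le> l" "l < ?N"
    then show "X (fst (pq (Suc l))) (snd (pq (Suc l))) \<le> X (fst (pq l)) (snd (pq l))"
      using noninc_perm_antimono[OF pq, of l "Suc l"] by simp
  qed (rule le)
  then show ?thesis
    using that[OF pq] chain_in_cube[OF noninc_perm_bij[OF pq] i] F0 by (simp add: z_def)
qed

section \<open>One iteration\<close>

lemma sorted_sum_diff:
  assumes pq: "noninc_perm n k X pq" and F: "\<forall>z\<in>cube n k. F z = G z - H z"
  shows "sorted_sum n k F pq X = sorted_sum n k G pq X - sorted_sum n k H pq X"
proof -
  have F: "F (chain pq i) = G (chain pq i) - H (chain pq i)" if "i \<le> (k-1) * n" for i
    using F chain_in_cube[OF noninc_perm_bij[OF pq] that] by blast
  show ?thesis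
    unfolding sorted_sum_def sum_subtractf[symmetric]
  proof (rule sum.cong[OF refl])
    fix i assume "i \<in> {1..(k-1) * n}"
    then have "i \<le> (k-1) * n" and "i - 1 \<le> (k-1) * n"
      by auto
    then show "X (fst (pq i)) (snd (pq i)) * (F (chain pq i) - F (chain pq (i - 1))) =
        X (fst (pq i)) (snd (pq i)) * (G (chain pq i) - G (chain pq (i - 1))) -
        X (fst (pq i)) (snd (pq i)) * (H (chain pq i) - H (chain pq (i - 1)))"
      by (simp only: F) (simp add: algebra_simps)
  qed
qed

text \<open>
  The chain of inequalities on which everything depends. The first two conclusions are the invariant that
  the current matrix is always the \<open>0/1\<close> matrix of the current point. In the third, \<open>z\<close> competes in the
  subproblem through \<open>\<Theta>\<^sup>-\<^sup>1(z)\<close>, and since \<open>pq\<close> sorts this matrix the linearization of \<open>h\<close> is exact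
  there.
\<close>

lemma dca_ls_step_bound:
  assumes F: "\<forall>z\<in>cube n k. F z = G z - H z"
    and G0: "G (\<lambda>_. 0) = 0" and H0: "H (\<lambda>_. 0) = 0"
    and step: "dca_ls_step n k F G H \<epsilon>\<^sub>x x (Theta_inv n k x) xbar pq Y Xt x' X'"
    and x: "x \<in> cube n k"
  shows "x' \<in> cube n k" and "X' = Theta_inv n k x'"
    and "\<And>z. z \<in> cube n k \<Longrightarrow> noninc_perm n k (Theta_inv n k z) pq \<Longrightarrow> F x' \<le> F z + \<epsilon>\<^sub>x"
proof -
  let ?\<phi> = "\<lambda>Z. cont_ext n k G Z - ereal (frobenius n k Y Z)"
  let ?D = "row_noninc n k {0..1}"
  have pq: "noninc_perm n k (Theta_inv n k x) pq"
    and Ysub: "Y \<in> subdifferential n k (cont_ext n k H) (Theta_inv n k x)"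
    and Y: "\<forall>i\<in>{1..(k-1) * n}. Y (fst (pq i)) (snd (pq i)) = H (chain pq i) - H (chain pq (i - 1))"
    and solves: "solves_upto ?\<phi> ?D \<epsilon>\<^sub>x Xt"
    and nxt: "if Xt \<in> row_noninc n k {0, 1} then x' = Theta n k Xt \<and> X' = Xt
      else x' \<in> roundings n k F Xt \<and> X' = Theta_inv n k x'"
    using step unfolding dca_ls_step_def by auto
  have Xt: "Xt \<in> ?D"
    using solves by (simp add: solves_upto_def)
  have zero: "(\<lambda>_. 0) \<in> cube n k"
    by (simp add: cube_def)
  have F0: "F (\<lambda>_. 0) = 0"
    using F zero G0 H0 by simp
  obtain pq' where pq': "noninc_perm n k Xt pq'" and x': "x' \<in> cube n k"
    and X': "X' = Theta_inv n k x'" and rounded: "F x' \<le> sorted_sum n k F pq' Xt"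
  proof (cases "Xt \<in> row_noninc n k {0, 1}")
    case True
    then have x': "x' \<in> cube n k" and Xt_eq: "Theta_inv n k x' = Xt" "X' = Xt"
      using nxt binary_row_noninc_eq_Theta_inv[OF True] by auto
    obtain pq' where "noninc_perm n k Xt pq'"
      using noninc_perm_exists by blast
    then show ?thesis
      using that sorted_sum_Theta_inv[OF x', of pq' F] F0 x' Xt_eq by simp
  next
    case False
    then have "x' \<in> roundings n k F Xt" and X': "X' = Theta_inv n k x'"
      using nxt by auto
    from rounding_le_sorted_sum[where F = F, OF Xt this(1) F0] obtain pq' where
      "noninc_perm n k Xt pq'" "x' \<in> cube n k" "F x' \<le> sorted_sum n k F pq' Xt" .
    then show ?thesis
      using that X' by blast
  qed
  show "x' \<in> cube n k" and "X' = Theta_inv n k x'"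
    by (fact x' X')+
  \<comment> \<open>This holds for every matrix, sorted or not; sortedness enters when the right-hand side is
    identified with the extension of \<open>H\<close>.\<close>
  have frob: "frobenius n k Y Z = sorted_sum n k H pq Z" for Z
    unfolding frobenius_eq_perm_sum[OF noninc_perm_bij[OF pq]] sorted_sum_def
    by (rule sum.cong) (use Y in auto)
  have frob_vertex: "frobenius n k Y (Theta_inv n k z) = H z"
    if "z \<in> cube n k" "noninc_perm n k (Theta_inv n k z) pq" for z
    unfolding frob by (rule sorted_sum_Theta_inv[where F = H, OF that H0])
  have ext_vertex: "cont_ext n k E (Theta_inv n k z) = ereal (E z)"
    if "z \<in> cube n k" "noninc_perm n k (Theta_inv n k z) pq" "E (\<lambda>_. 0) = 0" for z E
    using cont_ext_eq_sorted_sum[OF Theta_inv_row_noninc[of UNIV] that(2)]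
      sorted_sum_Theta_inv[where F = E, OF that] by simp
  have "Xt \<in> matrices n k"
    using Xt by (simp add: row_noninc_def)
  then have "cont_ext n k H (Theta_inv n k x) +
      ereal (frobenius n k Y (\<lambda>i j. Xt i j - Theta_inv n k x i j)) \<le> cont_ext n k H Xt"
    using Ysub unfolding subdifferential_def by blast
  then have tangent: "frobenius n k Y Xt \<le> sorted_sum n k H pq' Xt"
    unfolding frobenius_diff frob_vertex[OF x pq] ext_vertex[where E = H, OF x pq H0]
      cont_ext_eq_sorted_sum[OF Xt pq']
    by simp
  show "F x' \<le> F z + \<epsilon>\<^sub>x" if z: "z \<in> cube n k" and pqz: "noninc_perm n k (Theta_inv n k z) pq" for z
  proof -
    have "?\<phi> Xt \<le> (INF Z\<in>?D. ?\<phi> Z) + ereal \<epsilon>\<^sub>x"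
      using solves by (simp add: solves_upto_def)
    also have "\<dots> \<le> ?\<phi> (Theta_inv n k z) + ereal \<epsilon>\<^sub>x"
      by (intro add_right_mono INF_lower Theta_inv_row_noninc) auto
    also have "\<dots> = ereal (F z + \<epsilon>\<^sub>x)"
      unfolding frob_vertex[OF z pqz] ext_vertex[where E = G, OF z pqz G0] using F z by simp
    finally have "sorted_sum n k G pq' Xt - frobenius n k Y Xt \<le> F z + \<epsilon>\<^sub>x"
      unfolding cont_ext_eq_sorted_sum[OF Xt pq'] by simp
    then show ?thesis
      using rounded tangent sorted_sum_diff[OF pq' F] by simp
  qed
qed

section \<open>The whole run\<close>

lemma finite_cube: "finite (cube n k)"
proof (rule finite_subset)
  show "cube n k \<subseteq> {f. \<forall>i. (i \<in> {1..n} \<longrightarrow> f i \<in> {0..k-1}) \<and> (i \<notin> {1..n} \<longrightarrow> f i = 0)}"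
    by (auto simp: cube_def)
  show "finite {f::nat \<Rightarrow> nat. \<forall>i. (i \<in> {1..n} \<longrightarrow> f i \<in> {0..k-1}) \<and> (i \<notin> {1..n} \<longrightarrow> f i = 0)}"
    by (rule finite_set_of_finite_funs) auto
qed

lemma telescoped_decrease:
  fixes D :: "nat \<Rightarrow> real"
  assumes "\<And>i. i < m \<Longrightarrow> D (Suc i) \<le> D i - \<epsilon>"
  shows "D m \<le> D 0 - real m * \<epsilon>"
  using assms
proof (induction m)
  case (Suc m)
  have "D m \<le> D 0 - real m * \<epsilon>"
    using Suc by simp
  moreover have "D (Suc m) \<le> D m - \<epsilon>"
    using Suc.prems by simp
  ultimately show ?case
    by (simp add: algebra_simps)
qed simp

theorem theorem4p5:
  fixes n k T M :: nat
    and F G H :: "(nat \<Rightarrow> nat) \<Rightarrow> real"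
    and \<epsilon> \<epsilon>\<^sub>x Fstar :: real
    and x xbar :: "nat \<Rightarrow> nat \<Rightarrow> nat"
    and X Y Xtilde :: "nat \<Rightarrow> nat \<Rightarrow> nat \<Rightarrow> real"
    and pq :: "nat \<Rightarrow> nat \<Rightarrow> nat \<times> nat"
  assumes "n \<ge> 1" and "k \<ge> 2"
    and "normalized G" and "submodular n k G"
    and "normalized H" and "submodular n k H"
    and "\<forall>z\<in>cube n k. F z = G z - H z"
    and "Fstar = Min (F ` cube n k)"
    and "\<epsilon> \<ge> 0" and "\<epsilon>\<^sub>x \<ge> 0"
    and "dca_ls_run n k F G H \<epsilon> \<epsilon>\<^sub>x T M x X xbar pq Y Xtilde"
  shows "(\<forall>t<M. F (x (t + 1)) \<le> F (x t) + \<epsilon>\<^sub>x)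
    \<and> (\<forall>t<M. row_stable n k (pq t) \<and> F (x t) - F (x (t + 1)) \<le> \<epsilon> \<longrightarrow>
          (\<forall>i\<in>{0..(k-1) * n}. F (x t) \<le> F (chain (pq t) i) + \<epsilon> + \<epsilon>\<^sub>x))
    \<and> (\<epsilon> > 0 \<and> real T > (F (x 0) - Fstar) / \<epsilon> \<longrightarrow>
          (\<exists>t<M. real t \<le> (F (x 0) - Fstar) / \<epsilon>
             \<and> F (x t) - F (x (t + 1)) \<le> \<epsilon>
             \<and> local_minimum n k F (\<epsilon> + \<epsilon>\<^sub>x) (x t)))"
proof (intro conjI)
  have F: "\<forall>z\<in>cube n k. F z = G z - H z" and G0: "G (\<lambda>_. 0) = 0" and H0: "H (\<lambda>_. 0) = 0"
    using assms(3,5,7) by (auto simp: normalized_def)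
  have step: "dca_ls_step n k F G H \<epsilon>\<^sub>x
      (x t) (X t) (xbar t) (pq t) (Y t) (Xtilde (t + 1)) (x (t + 1)) (X (t + 1))" if "t < M" for t
    using assms(11) that by (simp add: dca_ls_run_def)
  have inv: "x t \<in> cube n k \<and> X t = Theta_inv n k (x t)" if "t \<le> M" for t
    using that
  proof (induction t)
    case 0
    then show ?case
      using assms(11) by (simp add: dca_ls_run_def)
  next
    case (Suc t)
    then have x: "x t \<in> cube n k" and "X t = Theta_inv n k (x t)" and "t < M"
      by auto
    with step[of t] have "dca_ls_step n k F G H \<epsilon>\<^sub>x (x t) (Theta_inv n k (x t)) (xbar t) (pq t) (Y t)
        (Xtilde (t + 1)) (x (t + 1)) (X (t + 1))"
      by simp
    from dca_ls_step_bound(1,2)[OF F G0 H0 this x] show ?case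
      by simp
  qed
  have x_cube: "x t \<in> cube n k" if "t \<le> M" for t
    using inv[OF that] by simp
  have bound: "F (x (t + 1)) \<le> F z + \<epsilon>\<^sub>x"
    if "t < M" "z \<in> cube n k" "noninc_perm n k (Theta_inv n k z) (pq t)" for t z
    using dca_ls_step_bound(3)[OF F G0 H0 _ _ that(2,3)] step[OF that(1)] inv[of t] that(1) by auto
  have perm_x: "noninc_perm n k (Theta_inv n k (x t)) (pq t)"
    and perm_xbar: "noninc_perm n k (Theta_inv n k (xbar t)) (pq t)"
    and xbar: "is_arg_min F (\<lambda>z. z \<in> nbhd n k (x t)) (xbar t)" if "t < M" for t
    using step[OF that] inv[of t] that by (auto simp: dca_ls_step_def)
  show "\<forall>t<M. F (x (t + 1)) \<le> F (x t) + \<epsilon>\<^sub>x"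
    using bound x_cube perm_x by simp
  show "\<forall>t<M. row_stable n k (pq t) \<and> F (x t) - F (x (t + 1)) \<le> \<epsilon> \<longrightarrow>
      (\<forall>i\<in>{0..(k-1) * n}. F (x t) \<le> F (chain (pq t) i) + \<epsilon> + \<epsilon>\<^sub>x)"
  proof (intro allI impI ballI)
    fix t i
    assume t: "t < M" and a: "row_stable n k (pq t) \<and> F (x t) - F (x (t + 1)) \<le> \<epsilon>"
      and i: "i \<in> {0..(k-1) * n}"
    have bij: "bij_betw (pq t) {1..(k-1) * n} ({1..n} \<times> {1..k-1})"
      by (rule noninc_perm_bij[OF perm_x[OF t]])
    have "F (x (t + 1)) \<le> F (chain (pq t) i) + \<epsilon>\<^sub>x"
      using bound[OF t] chain_in_cube[OF bij] noninc_perm_Theta_inv_chain[OF bij] a i by simp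
    then show "F (x t) \<le> F (chain (pq t) i) + \<epsilon> + \<epsilon>\<^sub>x"
      using a by simp
  qed
  show "\<epsilon> > 0 \<and> real T > (F (x 0) - Fstar) / \<epsilon> \<longrightarrow>
      (\<exists>t<M. real t \<le> (F (x 0) - Fstar) / \<epsilon> \<and> F (x t) - F (x (t + 1)) \<le> \<epsilon>
        \<and> local_minimum n k F (\<epsilon> + \<epsilon>\<^sub>x) (x t))"
  proof (intro impI, elim conjE)
    assume eps: "\<epsilon> > 0" and T: "real T > (F (x 0) - Fstar) / \<epsilon>"
    have Fstar: "Fstar \<le> F z" if "z \<in> cube n k" for z
      using that finite_cube by (simp add: assms(8))
    \<comment> \<open>The budget argument: \<open>m\<close> iterations without stopping cost \<open>m * \<epsilon>\<close>.\<close>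
    have count: "real m \<le> (F (x 0) - Fstar) / \<epsilon>"
      if "m \<le> M" "\<And>t. t < m \<Longrightarrow> \<not> F (x t) - F (x (t + 1)) \<le> \<epsilon>" for m
    proof -
      have "F (x (Suc t)) \<le> F (x t) - \<epsilon>" if "t < m" for t
        using \<open>t < m \<Longrightarrow> \<not> F (x t) - F (x (t + 1)) \<le> \<epsilon>\<close>[OF that] by simp
      then have "F (x m) \<le> F (x 0) - real m * \<epsilon>"
        by (rule telescoped_decrease)
      then have "real m * \<epsilon> \<le> F (x 0) - Fstar"
        using Fstar[OF x_cube[OF \<open>m \<le> M\<close>]] by linarith
      then show ?thesis
        using eps by (simp add: pos_le_divide_eq)
    qed
    have go_on: "\<not> F (x t) - F (x (t + 1)) \<le> \<epsilon>" if "t + 1 < M" for t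
      using assms(11) that by (simp add: dca_ls_run_def)
    have "\<exists>t. M = t + 1 \<and> F (x t) - F (x (t + 1)) \<le> \<epsilon>"
    proof (rule ccontr)
      \<comment> \<open>Otherwise all \<open>T\<close> iterations were performed without stopping, more than the budget allows.\<close>
      assume no_stop: "\<nexists>t. M = t + 1 \<and> F (x t) - F (x (t + 1)) \<le> \<epsilon>"
      then have "M = T"
        using assms(11) by (auto simp: dca_ls_run_def)
      moreover have "\<not> F (x t) - F (x (t + 1)) \<le> \<epsilon>" if "t < M" for t
        using no_stop go_on[of t] that by (cases "t + 1 = M") auto
      ultimately show False
        using count[of M] T by simp
    qed
    then obtain t where M: "M = t + 1" and stop: "F (x t) - F (x (t + 1)) \<le> \<epsilon>"
      by blast
    have t: "t < M"
      by (simp add: M)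
    have "real t \<le> (F (x 0) - Fstar) / \<epsilon>"
      by (rule count) (use go_on M in auto)
    moreover have "local_minimum n k F (\<epsilon> + \<epsilon>\<^sub>x) (x t)"
      unfolding local_minimum_def
    proof (intro conjI ballI)
      show "x t \<in> cube n k"
        using x_cube t by simp
      fix z assume "z \<in> nbhd n k (x t)"
      then have "F (xbar t) \<le> F z" and "xbar t \<in> cube n k"
        using xbar[OF t] unfolding is_arg_min_linorder by (auto simp: nbhd_def)
      then show "F (x t) \<le> F z + (\<epsilon> + \<epsilon>\<^sub>x)"
        using bound[OF t _ perm_xbar[OF t]] stop by fastforce
    qed
    ultimately show "\<exists>t<M. real t \<le> (F (x 0) - Fstar) / \<epsilon> \<and> F (x t) - F (x (t + 1)) \<le> \<epsilon>
        \<and> local_minimum n k F (\<epsilon> + \<epsilon>\<^sub>x) (x t)"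
      using t stop by blast
  qed
qed

end
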